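(* Let $m\ge1$ be an integer, let $f_k\in\mathcal{S}$ for $k=1,\ldots,m$, and suppose that $\sum_{k=1}^m\frac{z}{f_k(z)}\neq0$ for all $z\in\mathbb{D}$ (each $z/f_k(z)$ being taken as $1$ at $z=0$). Define $F$ on $\mathbb{D}$ by $$\frac{z}{F(z)}=\frac1m\sum_{k=1}^m\frac{z}{f_k(z)}$$ (with $F(0)=0$), and set $G(z)=r^{-1}F(rz)$. Then: (a) For every $\lambda\in(0,1]$, $G$ belongs to $\mathcal{U}(\lambda)$ for $0<r\le\sqrt{\lambda/(1+\lambda)}$. In particular, $F$ is univalent in the disk $|z|<1/\sqrt2$. (b) Let $$\lambda_0=1-\frac1m\left|\sum_{k=1}^m\frac{f_k''(0)}{2}\right|.$$ If $\lambda_0>0$, then $G$ belongs to $\mathcal{S}^*$ for $0<r\le\sqrt{\lambda_0/(1+\lambda_0)}$. In particular, $F$ is starlike (univalent) in the disk $|z|<1/\sqrt2$ whenever $f_k''(0)=0$ for each $k=1,\ldots,m$.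
   Context: $\mathbb{D}=\{z\in\mathbb{C}:|z|<1\}$. $\mathcal{A}$ is the class of functions $f$ analytic in $\mathbb{D}$ with $f(0)=0$, $f'(0)=1$. $\mathcal{S}$ is the set of $f\in\mathcal{A}$ that are univalent (injective) in $\mathbb{D}$. $\mathcal{S}^*$ is the set of starlike functions, i.e. $f\in\mathcal{S}$ with $\mathrm{Re}\,(zf'(z)/f(z))>0$ for all $z\in\mathbb{D}$ (removable singularity at $0$ filled in). For $\lambda\in(0,1]$, $\mathcal{U}(\lambda)$ is the set of $f\in\mathcal{A}$ (with $f(z)/z\ne0$ in $\mathbb{D}$) satisfying $$\left|f'(z)\left(\frac{z}{f(z)}\right)^2-1\right|<\lambda\quad\text{for all } z\in\mathbb{D},$$ where $z/f(z)$ is taken to be $1$ at $z=0$. Saying that $F$ is starlike in the disk $|z|<r$ means that $z\mapsto r^{-1}F(rz)$ belongs to $\mathcal{S}^*$. *)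

theory Defs
  imports "HOL-Complex_Analysis.Complex_Analysis"
begin

abbreviation unit_disk :: "complex set" where
  "unit_disk \<equiv> ball 0 1"

definition univalent_on :: "(complex \<Rightarrow> complex) \<Rightarrow> complex set \<Rightarrow> bool" where
  "univalent_on f D \<longleftrightarrow> f holomorphic_on D \<and> inj_on f D"

definition class_A :: "(complex \<Rightarrow> complex) set" where
  "class_A = {f. f holomorphic_on unit_disk \<and> f 0 = 0 \<and> deriv f 0 = 1}"

definition class_S :: "(complex \<Rightarrow> complex) set" where
  "class_S = {f \<in> class_A. univalent_on f unit_disk}"

text \<open>For \<open>f\<close> in \<open>class_A\<close>, both \<open>z / f z\<close> and \<open>z f'(z) / f z\<close> have a removable
  singularity at 0, with limit 1 there.\<close>

definition z_over :: "(complex \<Rightarrow> complex) \<Rightarrow> complex \<Rightarrow> complex" where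
  "z_over f z = (if z = 0 then 1 else z / f z)"

definition z_log_deriv :: "(complex \<Rightarrow> complex) \<Rightarrow> complex \<Rightarrow> complex" where
  "z_log_deriv f z = (if z = 0 then 1 else z * deriv f z / f z)"

definition class_S_star :: "(complex \<Rightarrow> complex) set" where
  "class_S_star = {f \<in> class_S. \<forall>z\<in>unit_disk. Re (z_log_deriv f z) > 0}"

text \<open>The condition that \<open>f z / z\<close> does not vanish is only stated away from 0, as the
  value at 0 is \<open>f'(0) = 1\<close>.\<close>

definition class_U :: "real \<Rightarrow> (complex \<Rightarrow> complex) set" where
  "class_U l = {f \<in> class_A.
     (\<forall>z\<in>unit_disk - {0}. f z / z \<noteq> 0) \<and>
     (\<forall>z\<in>unit_disk. cmod (deriv f z * (z_over f z)\<^sup>2 - 1) < l)}"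

definition dilation :: "real \<Rightarrow> (complex \<Rightarrow> complex) \<Rightarrow> complex \<Rightarrow> complex" where
  "dilation r F z = F (of_real r * z) / of_real r"

definition starlike_in_disk :: "(complex \<Rightarrow> complex) \<Rightarrow> real \<Rightarrow> bool" where
  "starlike_in_disk F r \<longleftrightarrow> dilation r F \<in> class_S_star"

end

theory Submission
  imports Defs
begin

text \<open>Write \<open>z / F z = u z = 1 + \<Sum> b n * z ^ n\<close>. The theorem rests on one piece of information about
  the coefficients, the area bound \<open>\<Sum> (n - 1) * |b n|\<^sup>2 \<le> 1\<close> over \<open>n \<ge> 2\<close>. For a
  single \<open>f\<close> in \<open>class_S\<close> it is Gronwall's area theorem (\<open>area_theorem\<close>) applied to the injective
  function \<open>1 / f z = 1 / z + b 1 + b 2 * z + \<dots>\<close>, and it survives averaging because the squared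
  modulus is convex; that is why the sum of the \<open>z / f k z\<close> is the right way to combine the
  functions. By Cauchy-Schwarz the bound yields
  \<open>\<Sum> (n - 1) * |b n| * t ^ n \<le> t\<^sup>2 / (1 - t\<^sup>2)\<close>, which is below \<open>l\<close> as soon as
  \<open>t < sqrt (l / (1 + l))\<close> (\<open>tail_less\<close>). The rest is a comparison with this sum: it
  majorises \<open>F' * (z / F)\<^sup>2 - 1\<close> (\<open>defect_le\<close>), it makes \<open>F\<close> injective where it is below \<open>1\<close>
  (\<open>F_inj_on\<close>), and \<open>F\<close> is starlike where it is below \<open>1 - |b 1|\<close>
  (\<open>Re_z_log_deriv_pos\<close>). Since \<open>b 1\<close> is the average of \<open>- f k''(0) / 2\<close>, the number
  \<open>lambda0\<close> is \<open>1 - |b 1|\<close>.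

  The area theorem is proved by comparing two estimates of the area of the image of an
  annulus \<open>\<epsilon> < |z| < \<rho>\<close> under \<open>g = 1 / f\<close>. From below, this area is the integral of \<open>|g'|\<^sup>2\<close>
  (change of variables, by injectivity), to which Bessel's inequality applies on each circle. From
  above, the image lies inside the curve traced by \<open>g\<close> on \<open>|z| = \<epsilon>\<close>, which is an
  ellipse up to a small error; a real-linear map straightens the ellipse to a disk, and
  a maximum-principle argument (\<open>twisted_bound_outside_circle\<close>) shows that the image cannot leave it.\<close>

section \<open>Area of the image of a rectangle under an injective holomorphic map\<close>

text \<open>The change-of-variables theorem lives on \<open>real^2\<close>, iterated integration on
  \<open>real \<times> real\<close>; this transfers integrals over rectangles from the latter to the former.\<close>

lemma has_integral_vec2:
  fixes \<phi> :: "real \<times> real \<Rightarrow> real"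
  assumes "(\<phi> has_integral i) (cbox (a, c) (b, d))"
  shows "((\<lambda>v::real^2. \<phi> (v$1, v$2)) has_integral i) (cbox (vector [a, c]) (vector [b, d]))"
proof -
  let ?g = "\<lambda>v::real^2. (v$1, v$2)"
  let ?h = "\<lambda>p::real \<times> real. (vector [fst p, snd p] :: real^2)"
  have hg: "?h (?g v) = v" for v
    by (simp add: vec_eq_iff forall_2)
  have gh: "?g (?h p) = p" for p
    by simp
  have g_cbox: "?g ` cbox u v = cbox (?g u) (?g v)" for u v
  proof
    show "?g ` cbox u v \<subseteq> cbox (?g u) (?g v)"
      by (auto simp: mem_box_cart forall_2)
    show "cbox (?g u) (?g v) \<subseteq> ?g ` cbox u v"
    proof
      fix p assume "p \<in> cbox (?g u) (?g v)"
      then have "?h p \<in> cbox u v"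
        by (cases p) (auto simp: mem_box_cart forall_2)
      then show "p \<in> ?g ` cbox u v"
        using gh[of p] by (metis (no_types, lifting) image_eqI)
    qed
  qed
  have h_cbox: "?h ` cbox u v = cbox (?h u) (?h v)" for u v
  proof -
    have "cbox u v = ?g ` cbox (?h u) (?h v)"
      unfolding g_cbox gh ..
    then show ?thesis
      by (simp only: image_image hg image_ident)
  qed
  have cont: "measure lborel (?g ` cbox u v) = 1 * measure lborel (cbox u v)" for u v :: "real^2"
  proof -
    have "(\<exists>i::2. P i) \<longleftrightarrow> P 1 \<or> P 2" for P
      by (metis exhaust_2)
    then show ?thesis
      unfolding g_cbox content_Pair
      by (auto simp: content_cbox_if_cart interval_eq_empty_cart UNIV_2 content_real_if)
  qed
  have "((\<lambda>x. \<phi> (?g x)) has_integral (1 / 1) *\<^sub>R i) (?h ` cbox (a, c) (b, d))"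
  proof (rule has_integral_twiddle[OF _ hg gh])
    show "\<exists>w z. ?g ` cbox u v = cbox w z" for u v using g_cbox by blast
    show "\<exists>w z. ?h ` cbox u v = cbox w z" for u v using h_cbox by blast
    show "isCont ?g x" for x by (intro continuous_intros)
  qed (use assms cont in auto)
  then show ?thesis
    unfolding h_cbox by simp
qed

definition vec_of_complex :: "complex \<Rightarrow> real^2" where
  "vec_of_complex w = vector [Re w, Im w]"

lemma bounded_linear_vec_of_complex: "bounded_linear vec_of_complex"
  unfolding vec_of_complex_def
  by (rule linear_conv_bounded_linear[THEN iffD1], rule linearI)
     (auto simp: vec_eq_iff forall_2)

lemma norm_vec_of_complex: "norm (vec_of_complex w) = cmod w"
  by (simp add: vec_of_complex_def norm_vec_def L2_set_def UNIV_2 cmod_def)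

lemma inj_vec_of_complex: "inj vec_of_complex"
  by (auto simp: inj_def vec_of_complex_def complex_eq_iff vec_eq_iff forall_2)

text \<open>The area of \<open>h ` Q\<close> is the integral of \<open>|h'|\<^sup>2\<close>. Composing with the real-linear map
  \<open>M w = w - \<beta> * cnj w\<close>, whose determinant is \<open>1 - |\<beta>|\<^sup>2\<close>, turns this into a comparison with the
  area of a disk even when \<open>h ` Q\<close> is only known to lie in an ellipse (the preimage of the
  disk under \<open>M\<close>). In the area theorem, a round disk around the ellipse would cost
  a term that does not vanish in the limit.\<close>

lemma area_inequality:
  fixes h h' :: "complex \<Rightarrow> complex" and \<beta> :: complex and a b c d R :: real
  defines "Q \<equiv> {s. a < Re s \<and> Re s < b \<and> c < Im s \<and> Im s < d}"
  assumes der: "\<And>s. s \<in> Q \<Longrightarrow> (h has_field_derivative h' s) (at s)"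
    and inj: "inj_on h Q"
    and bound: "\<And>s. s \<in> Q \<Longrightarrow> cmod (h s - \<beta> * cnj (h s)) \<le> R"
    and \<beta>: "cmod \<beta> < 1" and R: "0 \<le> R"
    and cont: "continuous_on (cbox (a, c) (b, d)) (\<lambda>(x, y). (cmod (h' (Complex x y)))\<^sup>2)"
  shows "(1 - (cmod \<beta>)\<^sup>2) * integral {a..b} (\<lambda>x. integral {c..d} (\<lambda>y. (cmod (h' (Complex x y)))\<^sup>2))
           \<le> pi * R\<^sup>2"
proof -
  define I where "I = integral {a..b} (\<lambda>x. integral {c..d} (\<lambda>y. (cmod (h' (Complex x y)))\<^sup>2))"
  define C where "C = (\<lambda>v::real^2. Complex (v$1) (v$2))"
  define M where "M = (\<lambda>w. w - \<beta> * cnj w)"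
  define \<Phi> where "\<Phi> = (\<lambda>v. vec_of_complex (M (h (C v))))"
  define \<Phi>' where "\<Phi>' = (\<lambda>v e. vec_of_complex (M (h' (C v) * C e)))"
  define B where "B = box (vector [a, c] :: real^2) (vector [b, d])"
  have CQ: "C v \<in> Q \<longleftrightarrow> v \<in> B" for v
    by (auto simp: C_def Q_def B_def mem_box_cart forall_2)
  have \<beta>2: "(cmod \<beta>)\<^sup>2 < 1"
    using \<beta> by (simp add: power_less_one_iff)
  have linC: "bounded_linear C"
    by (rule linear_conv_bounded_linear[THEN iffD1], rule linearI)
       (auto simp: C_def complex_eq_iff)
  have linM: "bounded_linear M"
    unfolding M_def
    by (intro bounded_linear_sub bounded_linear_ident bounded_linear_const_mult bounded_linear_cnj)
  have injM: "w = w'" if "M w = M w'" for w w'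
  proof -
    have "w - w' = \<beta> * cnj (w - w')" using that by (simp add: M_def algebra_simps)
    then have "cmod (w - w') = cmod \<beta> * cmod (w - w')" 
      by (metis complex_mod_cnj norm_mult)
    with \<beta> show ?thesis by auto
  qed
  have injC: "inj C" by (auto simp: C_def inj_def vec_eq_iff forall_2)
  have deriv\<Phi>: "(\<Phi> has_derivative \<Phi>' v) (at v within B)" if "v \<in> B" for v
  proof -
    have "(C has_derivative C) (at v within B)"
      using linC by (rule bounded_linear_imp_has_derivative)
    moreover have "(h has_derivative (\<lambda>e. h' (C v) * e)) (at (C v))"
      using der[of "C v"] that CQ by (simp add: has_field_derivative_def)
    ultimately have "((\<lambda>v. h (C v)) has_derivative (\<lambda>e. h' (C v) * C e)) (at v within B)"
      by (rule has_derivative_compose)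
    then show ?thesis unfolding \<Phi>_def \<Phi>'_def
      by (intro bounded_linear.has_derivative[OF bounded_linear_vec_of_complex] bounded_linear.has_derivative[OF linM])
  qed
  have inj\<Phi>: "inj_on \<Phi> B"
  proof (rule inj_onI)
    fix v w assume vw: "v \<in> B" "w \<in> B" "\<Phi> v = \<Phi> w"
    then have "h (C v) = h (C w)"
      unfolding \<Phi>_def using injM inj_vec_of_complex by (metis injD)
    then show "v = w" using vw inj injC CQ by (metis inj_onD injD)
  qed
  have det\<Phi>: "\<bar>det (matrix (\<Phi>' v))\<bar> = (1 - (cmod \<beta>)\<^sup>2) * (cmod (h' (Complex (v$1) (v$2))))\<^sup>2" for v
  proof -
    define D where "D = h' (C v)"
    have "det (matrix (\<Phi>' v)) = (1 - (cmod \<beta>)\<^sup>2) * (cmod D)\<^sup>2"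
      unfolding det_2 matrix_def \<Phi>'_def M_def C_def[abs_def] vec_of_complex_def D_def[symmetric, unfolded C_def]
      by (simp add: axis_def cmod_power2) algebra
    then show ?thesis using \<beta>2 by (simp add: D_def C_def abs_mult)
  qed
  have int: "((\<lambda>(x, y). (cmod (h' (Complex x y)))\<^sup>2) has_integral I) (cbox (a, c) (b, d))"
  proof -
    have "integral (cbox (a, c) (b, d)) (\<lambda>(x, y). (cmod (h' (Complex x y)))\<^sup>2) = I"
      unfolding I_def using integral_prod_continuous[OF cont] by simp
    then show ?thesis using integrable_continuous[OF cont] has_integral_integral by metis
  qed
  have "((\<lambda>v. \<bar>det (matrix (\<Phi>' v))\<bar>) has_integral (1 - (cmod \<beta>)\<^sup>2) * I) B"
    unfolding B_def has_integral_open_interval det\<Phi>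
    using has_integral_mult_right[OF has_integral_vec2[OF int]] by simp
  moreover have "B \<in> sets lebesgue" by (simp add: B_def)
  ultimately have meas: "\<Phi> ` B \<in> lmeasurable" "measure lebesgue (\<Phi> ` B) = (1 - (cmod \<beta>)\<^sup>2) * I"
    using has_measure_differentiable_image[OF _ deriv\<Phi> inj\<Phi>] by blast+
  have "\<Phi> ` B \<subseteq> cball 0 R"
    using bound CQ by (auto simp: \<Phi>_def M_def norm_vec_of_complex)
  then have "measure lebesgue (\<Phi> ` B) \<le> measure lebesgue (cball (0::real^2) R)"
    using meas by (intro measure_mono_fmeasurable) auto
  also have "\<dots> = pi * R\<^sup>2"
    using R by (simp add: content_cball unit_ball_vol_2)
  finally show ?thesis using meas by (simp add: I_def)
qed

section \<open>Power series and their square means on circles\<close>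

lemma power_series_split_head:
  fixes a :: "nat \<Rightarrow> complex"
  assumes "\<And>z. cmod z < 1 \<Longrightarrow> (\<lambda>n. a n * z ^ n) sums p z"
  obtains q where "\<And>z. cmod z < 1 \<Longrightarrow> (\<lambda>n. a (Suc n) * z ^ n) sums q z"
    and "\<And>z. cmod z < 1 \<Longrightarrow> p z = a 0 + z * q z"
proof
  define q where "q = (\<lambda>z. \<Sum>n. a (Suc n) * z ^ n)"
  fix z :: complex assume z: "cmod z < 1"
  have summ: "summable (\<lambda>n. a (Suc n) * z ^ n)"
    using sums_summable[OF assms[OF z]] by (rule summable_powser_split_head[THEN iffD2])
  then show "(\<lambda>n. a (Suc n) * z ^ n) sums q z"
    unfolding q_def by (rule summable_sums)
  show "p z = a 0 + z * q z"
    using powser_split_head(1)[OF sums_summable[OF assms[OF z]]] sums_unique[OF assms[OF z]]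
    by (simp add: q_def mult.commute)
qed

lemma power_series_holomorphic_unit:
  fixes a :: "nat \<Rightarrow> complex"
  assumes "\<And>z. cmod z < 1 \<Longrightarrow> (\<lambda>n. a n * z ^ n) sums p z"
  shows "p holomorphic_on ball 0 1"
  by (rule power_series_holomorphic[where a = a]) (use assms in auto)

lemma continuous_on_circle:
  assumes "p holomorphic_on ball 0 1" and "0 < t" "t < 1"
  shows "continuous_on S (\<lambda>y. p (of_real t * cis y))"
proof (rule continuous_on_compose2[OF holomorphic_on_imp_continuous_on[OF assms(1)]])
  show "continuous_on S (\<lambda>y. of_real t * cis y)"
    by (intro continuous_intros)
qed (use assms in \<open>auto simp: norm_mult\<close>)

text \<open>Cauchy's theorem in the angular variable: \<open>dz = \<i> * z dy\<close> on the circle.\<close>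

lemma circle_mean_zero:
  assumes "q holomorphic_on ball 0 1" and "0 < t" "t < 1"
  shows "((\<lambda>y. of_real t * cis y * q (of_real t * cis y)) has_integral 0) {0..2*pi}"
proof -
  have "(q has_contour_integral 0) (circlepath 0 t)"
    by (rule Cauchy_theorem_convex_simple[OF assms(1)])
       (use assms in \<open>auto simp: path_image_circlepath\<close>)
  then have "((\<lambda>y. q (of_real t * cis y) * t * \<i> * cis y) has_integral 0) {0..2*pi}"
    unfolding circlepath_def by (subst (asm) has_contour_integral_part_circlepath_iff) auto
  then have "((\<lambda>y. (q (of_real t * cis y) * t * \<i> * cis y) * (- \<i>)) has_integral 0 * (- \<i>)) {0..2*pi}"
    by (rule has_integral_mult_left)
  then show ?thesis
    by (simp add: mult_ac)
qed

text \<open>Splitting \<open>p z = a 0 + z * q z\<close>, the cross term in \<open>|p|\<^sup>2\<close> integrates to zero, so the mean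
  square of \<open>p\<close> is \<open>|a 0|\<^sup>2\<close> plus \<open>t\<^sup>2\<close> times that of \<open>q\<close>. Iterating gives Bessel's
  inequality by induction, without double sums.\<close>

lemma bessel_circle:
  fixes a :: "nat \<Rightarrow> complex"
  assumes "\<And>z. cmod z < 1 \<Longrightarrow> (\<lambda>n. a n * z ^ n) sums p z" and t: "0 < t" "t < 1"
  shows "2 * pi * (\<Sum>n<N. (cmod (a n))\<^sup>2 * t ^ (2 * n))
           \<le> integral {0..2*pi} (\<lambda>y. (cmod (p (of_real t * cis y)))\<^sup>2)"
  using assms(1)
proof (induction N arbitrary: a p)
  case 0
  show ?case
    using continuous_on_circle[OF power_series_holomorphic_unit[OF 0] t]
    by (auto intro!: integral_nonneg integrable_continuous_interval continuous_intros)
next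
  case (Suc N)
  obtain q where q: "\<And>z. cmod z < 1 \<Longrightarrow> (\<lambda>n. a (Suc n) * z ^ n) sums q z"
    and pq: "\<And>z. cmod z < 1 \<Longrightarrow> p z = a 0 + z * q z"
    using power_series_split_head[OF Suc.prems] by metis
  have hol: "q holomorphic_on ball 0 1"
    by (rule power_series_holomorphic_unit[OF q])
  let ?z = "\<lambda>y. of_real t * cis y"
  define J where "J = integral {0..2*pi} (\<lambda>y. (cmod (q (?z y)))\<^sup>2)"
  have IH: "2 * pi * (\<Sum>n<N. (cmod (a (Suc n)))\<^sup>2 * t ^ (2 * n)) \<le> J"
    unfolding J_def using Suc.IH[OF q] by simp
  have eq: "(cmod (p (?z y)))\<^sup>2 =
      (cmod (a 0))\<^sup>2 + 2 * Re (cnj (a 0) * (?z y * q (?z y))) + t\<^sup>2 * (cmod (q (?z y)))\<^sup>2" for y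
  proof -
    have "(cmod (a 0 + w))\<^sup>2 = (cmod (a 0))\<^sup>2 + 2 * Re (cnj (a 0) * w) + (cmod w)\<^sup>2" for w
      unfolding cmod_power2 by (simp add: power2_eq_square algebra_simps)
    then show ?thesis
      using t by (simp add: pq norm_mult power_mult_distrib)
  qed
  have cross: "((\<lambda>y. 2 * Re (cnj (a 0) * (?z y * q (?z y)))) has_integral 2 * Re (cnj (a 0) * 0)) {0..2*pi}"
    by (intro has_integral_mult_right has_integral_Re circle_mean_zero[OF hol t])
  have sq: "((\<lambda>y. (cmod (q (?z y)))\<^sup>2) has_integral J) {0..2*pi}"
    unfolding J_def using continuous_on_circle[OF hol t]
    by (auto intro!: integrable_integral integrable_continuous_interval continuous_intros)
  have cst: "((\<lambda>y. (cmod (a 0))\<^sup>2) has_integral 2 * pi * (cmod (a 0))\<^sup>2) {0..2*pi}"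
    using has_integral_const_real[of "(cmod (a 0))\<^sup>2" 0 "2*pi"] by simp
  have "((\<lambda>y. (cmod (p (?z y)))\<^sup>2) has_integral
           2 * pi * (cmod (a 0))\<^sup>2 + 2 * Re (cnj (a 0) * 0) + t\<^sup>2 * J) {0..2*pi}"
    unfolding eq by (intro has_integral_add cst cross has_integral_mult_right sq)
  then have "integral {0..2*pi} (\<lambda>y. (cmod (p (?z y)))\<^sup>2) = 2 * pi * (cmod (a 0))\<^sup>2 + t\<^sup>2 * J"
    by (simp add: integral_unique)
  moreover have "2 * pi * (\<Sum>n<Suc N. (cmod (a n))\<^sup>2 * t ^ (2 * n)) =
      2 * pi * (cmod (a 0))\<^sup>2 + t\<^sup>2 * (2 * pi * (\<Sum>n<N. (cmod (a (Suc n)))\<^sup>2 * t ^ (2 * n)))"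
    by (simp add: sum.lessThan_Suc_shift sum_distrib_left algebra_simps power2_eq_square del: sum.lessThan_Suc)
  ultimately show ?case
    using mult_left_mono[OF IH, of "t\<^sup>2"] by simp
qed

section \<open>The area theorem\<close>

text \<open>Write \<open>g z = u z / z\<close>, \<open>M v = v - \<beta> * cnj v\<close>, \<open>w = g z\<^sub>0\<close>. The set of all \<open>v\<close> with
  \<open>|M v| \<le> R\<close> is convex (an ellipse if \<open>|\<beta>| < 1\<close>). If it did not contain \<open>w\<close>, a line would
  separate \<open>w\<close> from the image of the circle \<open>|z| = \<epsilon>\<close>, i.e. \<open>Re (\<gamma> * (g - w)) < 0\<close> on the circle,
  where \<open>v \<mapsto> Re (\<gamma> * v)\<close> is \<open>M\<close> followed by the inner product with \<open>A = M w\<close>. By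
  injectivity \<open>w\<close> is not attained for \<open>|z| \<le> \<epsilon>\<close>, so \<open>\<psi> = 1 / (g - w)\<close> is holomorphic there, and it
  vanishes at the pole \<open>0\<close> of \<open>g\<close>. But \<open>Re (cnj \<gamma> * \<psi>)\<close> is negative on the circle, which contradicts
  the maximum principle.\<close>

lemma twisted_bound_outside_circle:
  fixes u :: "complex \<Rightarrow> complex"
  assumes hol: "u holomorphic_on ball 0 1" and u0: "u 0 = 1"
    and inj: "inj_on (\<lambda>z. u z / z) (ball 0 1 - {0})"
    and circ: "\<And>z. cmod z = \<epsilon> \<Longrightarrow> cmod (u z / z - \<beta> * cnj (u z / z)) \<le> R"
    and \<epsilon>: "0 < \<epsilon>" and z0: "\<epsilon> \<le> cmod z\<^sub>0" "cmod z\<^sub>0 < 1"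
  shows "cmod (u z\<^sub>0 / z\<^sub>0 - \<beta> * cnj (u z\<^sub>0 / z\<^sub>0)) \<le> R"
proof (rule ccontr)
  define w where "w = u z\<^sub>0 / z\<^sub>0"
  define A where "A = w - \<beta> * cnj w"
  define \<gamma> where "\<gamma> = cnj A - A * cnj \<beta>"
  define \<psi> where "\<psi> = (\<lambda>z. z / (u z - w * z))"
  assume "\<not> ?thesis"
  then have A: "cmod A > R" by (simp add: A_def w_def)
  then have z0': "\<epsilon> < cmod z\<^sub>0" using circ[of z\<^sub>0] z0 by (force simp: A_def w_def)
  have nz: "u z - w * z \<noteq> 0" if "cmod z \<le> \<epsilon>" for z
  proof
    assume 0: "u z - w * z = 0"
    then have "z \<noteq> 0" using u0 by auto
    then have "u z / z = u z\<^sub>0 / z\<^sub>0" using 0 by (simp add: w_def field_simps)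
    moreover have "z\<^sub>0 \<noteq> 0" using z0' \<epsilon> by auto
    ultimately have "z = z\<^sub>0"
      using inj_onD[OF inj, of z z\<^sub>0] \<open>z \<noteq> 0\<close> that z0' z0 \<epsilon> by auto
    then show False using that z0' by simp
  qed
  have hol\<psi>: "(\<lambda>z. cnj \<gamma> * \<psi> z) holomorphic_on cball 0 \<epsilon>"
    unfolding \<psi>_def using nz z0' z0
    by (intro holomorphic_intros holomorphic_on_subset[OF hol]) auto
  have neg: "Re (cnj \<gamma> * \<psi> z) < 0" if z: "cmod z = \<epsilon>" for z
  proof -
    define g where "g = u z / z"
    define \<omega> where "\<omega> = g - w"
    have "z \<noteq> 0" using z \<epsilon> by auto
    then have \<omega>: "\<psi> z = 1 / \<omega>" "\<omega> \<noteq> 0"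
      using nz[of z] z by (auto simp: \<psi>_def \<omega>_def g_def field_simps)
    have id: "Re (\<gamma> * v) = Re (cnj A * (v - \<beta> * cnj v))" for v
      by (simp add: \<gamma>_def algebra_simps)
    have "Re (\<gamma> * \<omega>) = Re (cnj A * (g - \<beta> * cnj g)) - Re (cnj A * A)"
      unfolding id by (simp add: A_def \<omega>_def algebra_simps)
    also have "Re (cnj A * A) = (cmod A)\<^sup>2"
      using cmod_power2[of A] by (simp add: power2_eq_square)
    also have "Re (cnj A * (g - \<beta> * cnj g)) \<le> cmod A * R"
      using complex_Re_le_cmod[of "cnj A * (g - \<beta> * cnj g)"] circ[OF z] 
      by (smt (verit) complex_mod_cnj g_def mult_left_mono norm_ge_zero norm_mult)
    also have "cmod A * R - (cmod A)\<^sup>2 < 0"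
    proof -
      have "0 \<le> R" using circ[OF z] norm_ge_zero order_trans by blast
      then have "cmod A * R < cmod A * cmod A" using A by (intro mult_strict_left_mono) auto
      then show ?thesis by (simp add: power2_eq_square)
    qed
    finally have "Re (\<gamma> * \<omega>) < 0" by simp
    moreover have "Re (cnj \<gamma> * (1 / \<omega>)) = Re (\<gamma> * \<omega>) / (cmod \<omega>)\<^sup>2"
      by (simp add: Re_divide cmod_power2)
    ultimately show ?thesis
      using \<omega> by (simp add: divide_neg_pos)
  qed
  have cont: "continuous_on (sphere 0 \<epsilon>) (\<lambda>z. Re (cnj \<gamma> * \<psi> z))"
    using holomorphic_on_imp_continuous_on[OF hol\<psi>]
    by (intro continuous_on_Re) (auto elim: continuous_on_subset)
  obtain z\<^sub>1 where z1: "z\<^sub>1 \<in> sphere 0 \<epsilon>"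
    and max: "\<And>z. z \<in> sphere 0 \<epsilon> \<Longrightarrow> Re (cnj \<gamma> * \<psi> z) \<le> Re (cnj \<gamma> * \<psi> z\<^sub>1)"
    using continuous_attains_sup[OF compact_sphere _ cont] \<epsilon> by auto
  have "Re (cnj \<gamma> * \<psi> 0) \<le> Re (cnj \<gamma> * \<psi> z\<^sub>1)"
  proof (rule maximum_real_frontier[where f = "\<lambda>z. cnj \<gamma> * \<psi> z" and S = "cball 0 \<epsilon>"])
    show "(\<lambda>z. cnj \<gamma> * \<psi> z) holomorphic_on interior (cball 0 \<epsilon>)"
      by (rule holomorphic_on_subset[OF hol\<psi> interior_subset])
    show "continuous_on (closure (cball 0 \<epsilon>)) (\<lambda>z. cnj \<gamma> * \<psi> z)"
      using holomorphic_on_imp_continuous_on[OF hol\<psi>] by simp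
  qed (use max \<epsilon> in auto)
  also have "\<dots> < 0" using neg z1 by auto
  finally show False by (simp add: \<psi>_def)
qed

lemma power_series_euler:
  fixes b :: "nat \<Rightarrow> complex"
  assumes sums: "\<And>z. cmod z < 1 \<Longrightarrow> (\<lambda>n. b n * z ^ n) sums u z" and z: "cmod z < 1"
  shows "(\<lambda>n. of_nat n * b n * z ^ n) sums (z * deriv u z)"
proof -
  have "(u has_field_derivative deriv u z) (at z)"
    using holomorphic_derivI[OF power_series_holomorphic_unit[OF sums] open_ball] z by simp
  then have "(\<lambda>n. diffs b n * z ^ n) sums deriv u z"
    using termdiffs_sums_strong[OF sums _ z] by blast
  then have "(\<lambda>n. z * (diffs b n * z ^ n)) sums (z * deriv u z)"
    by (rule sums_mult)
  then have "(\<lambda>n. of_nat (Suc n) * b (Suc n) * z ^ Suc n) sums (z * deriv u z)"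
    by (simp add: diffs_def mult_ac)
  then show ?thesis
    using sums_Suc_iff[of "\<lambda>n. of_nat n * b n * z ^ n"] by simp
qed

text \<open>The quantitative form on the annulus \<open>\<epsilon> < |z| < \<rho>\<close>, parametrised by the exponential map on
  a rectangle. Near the pole \<open>u z / z - b 1 = 1 / z + b 2 * z + O(z\<^sup>2)\<close>, and on \<open>|z| = \<epsilon>\<close> one has
  \<open>z = \<epsilon>\<^sup>2 * cnj (1 / z)\<close>; so the circle goes, up to \<open>O(\<epsilon>\<^sup>2)\<close>, to the ellipse
  \<open>\<omega> + \<beta> * cnj \<omega>\<close>, \<open>|\<omega>| = 1 / \<epsilon>\<close>, with \<open>\<beta> = b 2 * \<epsilon>\<^sup>2\<close>, and \<open>M w = w - \<beta> * cnj w\<close> takes it to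
  an almost round circle of radius \<open>(1 - |\<beta>|\<^sup>2) / \<epsilon>\<close>. The resulting upper bound for the area is
  \<open>pi * (1 / \<epsilon> + O(\<epsilon>\<^sup>2))\<^sup>2 = pi / \<epsilon>\<^sup>2 + O(\<epsilon>)\<close>; the terms \<open>1 / \<epsilon>\<^sup>2\<close> cancel against the
  lower bound for the area from Bessel's inequality.\<close>

lemma area_theorem_annulus:
  fixes b :: "nat \<Rightarrow> complex"
  assumes sums: "\<And>z. cmod z < 1 \<Longrightarrow> (\<lambda>n. b n * z ^ n) sums u z" and u0: "u 0 = 1"
    and inj: "inj_on (\<lambda>z. u z / z) (ball 0 1 - {0})"
    and K: "\<And>z. cmod z \<le> 1 / 2 \<Longrightarrow> cmod (u z - (1 + b 1 * z + b 2 * z\<^sup>2)) \<le> K * cmod z ^ 3"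
    and \<epsilon>: "0 < \<epsilon>" "\<epsilon> \<le> 1 / 2" "cmod (b 2) * \<epsilon>\<^sup>2 \<le> 1 / 2" and \<rho>: "\<epsilon> < \<rho>" "\<rho> < 1"
  shows "(\<Sum>n<N. real n * (cmod (b (Suc n)))\<^sup>2 * (\<rho> ^ (2 * n) - \<epsilon> ^ (2 * n)))
           \<le> 1 / \<rho>\<^sup>2 + 8 * K * \<epsilon> + 16 * K\<^sup>2 * \<epsilon> ^ 4"
proof -
  define p where "p = (\<lambda>z. z * deriv u z - u z)"
  define v where "v = (\<lambda>z. u z - b 1 * z)"
  define h where "h = (\<lambda>s. v (exp s) / exp s)"
  define h' where "h' = (\<lambda>s. p (exp s) / exp s)"
  define \<beta> where "\<beta> = b 2 * \<epsilon>\<^sup>2"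
  define \<delta> where "\<delta> = 1 - (cmod \<beta>)\<^sup>2"
  define R where "R = \<delta> * (1 / \<epsilon> + 4 * K * \<epsilon>\<^sup>2)"
  define Q where "Q = {s. ln \<epsilon> < Re s \<and> Re s < ln \<rho> \<and> 0 < Im s \<and> Im s < 2 * pi}"
  have b0: "b 0 = 1"
    using sums[of 0] u0 by (simp add: powser_sums_zero_iff)
  have \<rho>0: "0 < \<rho>" using \<epsilon> \<rho> by simp
  have hol: "u holomorphic_on ball 0 1"
    by (rule power_series_holomorphic_unit[OF sums])
  have du: "(u has_field_derivative deriv u z) (at z)" if "cmod z < 1" for z
    using holomorphic_derivI[OF hol open_ball] that by simp
  have K0: "0 \<le> K"
    using order_trans[OF norm_ge_zero K[of "1/2"]] by (simp add: zero_le_mult_iff)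
  have \<beta>: "cmod \<beta> \<le> 1 / 2"
    using \<epsilon> by (simp add: \<beta>_def norm_mult norm_power)
  have "(cmod \<beta>)\<^sup>2 \<le> (1 / 2)\<^sup>2" using \<beta> by (intro power_mono) auto
  then have \<delta>: "1 / 2 \<le> \<delta>" "\<delta> \<le> 1" by (auto simp: \<delta>_def power2_eq_square)
  have R0: "0 \<le> R" unfolding R_def using \<delta> K0 \<epsilon> by (intro mult_nonneg_nonneg add_nonneg_nonneg) auto
  have p_sums: "(\<lambda>n. ((of_nat n - 1) * b n) * z ^ n) sums p z" if z: "cmod z < 1" for z
  proof -
    from sums_diff[OF power_series_euler[OF sums z] sums[OF z]] show ?thesis
      by (simp add: p_def algebra_simps)
  qed
  have p_hol: "p holomorphic_on ball 0 1"
    by (rule power_series_holomorphic_unit[OF p_sums])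
  have expQ: "\<epsilon> < cmod (exp s)" "cmod (exp s) < \<rho>" if "s \<in> Q" for s
  proof -
    from that have "exp (ln \<epsilon>) < exp (Re s)" "exp (Re s) < exp (ln \<rho>)"
      by (auto simp: Q_def)
    then show "\<epsilon> < cmod (exp s)" "cmod (exp s) < \<rho>" using \<epsilon> \<rho>0 by auto
  qed
  have expQ1: "exp s \<in> ball 0 1" if "s \<in> Q" for s
    unfolding mem_ball_0 using expQ(2)[OF that] \<rho> by linarith
  have injv: "inj_on (\<lambda>z. v z / z) (ball 0 1 - {0})"
  proof (rule inj_onI)
    fix x y assume xy: "x \<in> ball 0 1 - {0}" "y \<in> ball 0 1 - {0}" "v x / x = v y / y"
    then have "u x / x = u y / y" by (auto simp: v_def diff_divide_distrib)
    then show "x = y" using inj xy by (auto dest: inj_onD)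
  qed
  \<comment> \<open>Subtracting \<open>b 1\<close> translates the image; the choice of \<open>\<beta>\<close> makes \<open>w - \<beta> * cnj w\<close> lose the
      term \<open>b 2 * z\<close> of \<open>v z / z\<close>.\<close>
  have circ: "cmod (v z / z - \<beta> * cnj (v z / z)) \<le> R" if z: "cmod z = \<epsilon>" for z
  proof -
    define e where "e = (u z - (1 + b 1 * z + b 2 * z\<^sup>2)) / z"
    have z0: "z \<noteq> 0" using z \<epsilon> by auto
    have zz: "z * cnj z = \<epsilon>\<^sup>2" using z by (simp add: complex_norm_square[symmetric])
    have vz: "v z / z = 1 / z + b 2 * z + e"
      using z0 by (simp add: v_def e_def field_simps power2_eq_square)
    have "\<beta> * cnj (1 / z) = b 2 * z"
      using z0 by (simp add: \<beta>_def zz[symmetric] flip: of_real_power)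
    moreover have "\<beta> * cnj (b 2 * z) = (cmod \<beta>)\<^sup>2 / z"
    proof -
      have "\<beta> * cnj (b 2 * z) * z = b 2 * cnj (b 2) * \<epsilon>\<^sup>2 * (z * cnj z)"
        by (simp add: \<beta>_def mult_ac)
      also have "\<dots> = (cmod \<beta>)\<^sup>2"
        unfolding zz complex_norm_square by (simp add: \<beta>_def mult_ac)
      finally show ?thesis using z0 by (simp add: eq_divide_eq)
    qed
    ultimately have "v z / z - \<beta> * cnj (v z / z) = \<delta> / z + e - \<beta> * cnj e"
      unfolding vz \<delta>_def by (simp add: algebra_simps diff_divide_distrib)
    also have "cmod \<dots> \<le> cmod (\<delta> / z) + cmod e + cmod (\<beta> * cnj e)"
      by (smt (verit) norm_triangle_ineq norm_triangle_ineq4)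
    also have "cmod (\<delta> / z) = \<delta> / \<epsilon>"
      using \<delta> z by (simp add: norm_divide)
    also have "cmod (\<beta> * cnj e) \<le> 1 * cmod e"
      unfolding norm_mult complex_mod_cnj using \<beta> by (intro mult_right_mono) auto
    also have "cmod e \<le> K * \<epsilon>\<^sup>2"
      using K[of z] z \<epsilon> by (simp add: e_def norm_divide field_simps power3_eq_cube power2_eq_square)
    finally have "cmod (v z / z - \<beta> * cnj (v z / z)) \<le> \<delta> / \<epsilon> + 2 * (K * \<epsilon>\<^sup>2)" by simp
    also have "\<dots> \<le> R"
      using mult_right_mono[OF \<delta>(1), of "4 * (K * \<epsilon>\<^sup>2)"] K0 by (simp add: R_def algebra_simps)
    finally show ?thesis .
  qed
  define I where "I = (\<lambda>x. integral {0..2*pi} (\<lambda>y. (cmod (h' (Complex x y)))\<^sup>2))"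
  have cont: "continuous_on (cbox (ln \<epsilon>, 0) (ln \<rho>, 2 * pi)) (\<lambda>(x, y). (cmod (h' (Complex x y)))\<^sup>2)"
  proof -
    have "continuous_on (cbox (ln \<epsilon>, 0) (ln \<rho>, 2 * pi)) (\<lambda>q. p (exp (Complex (fst q) (snd q))))"
    proof (rule continuous_on_compose2[OF holomorphic_on_imp_continuous_on[OF p_hol]])
      show "(\<lambda>q. exp (Complex (fst q) (snd q))) ` cbox (ln \<epsilon>, 0) (ln \<rho>, 2 * pi) \<subseteq> ball 0 1"
      proof clarsimp
        fix x assume "x \<le> ln \<rho>"
        then show "x < 0" using \<rho> \<rho>0 ln_less_zero by (meson order_le_less_trans)
      qed
    qed (auto simp: Complex_eq intro!: continuous_intros)
    then show ?thesis unfolding h'_def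
      by (auto simp: Complex_eq case_prod_unfold intro!: continuous_intros)
  qed
  have upper: "\<delta> * integral {ln \<epsilon>..ln \<rho>} I \<le> pi * R\<^sup>2"
    unfolding \<delta>_def I_def
  proof (rule area_inequality[OF _ _ _ _ R0 cont])
    fix s assume "s \<in> {s. ln \<epsilon> < Re s \<and> Re s < ln \<rho> \<and> 0 < Im s \<and> Im s < 2 * pi}"
    then have s: "s \<in> Q" by (simp add: Q_def)
    then have s1: "cmod (exp s) < 1" using expQ(2)[OF s] \<rho> by linarith
    show "cmod (h s - \<beta> * cnj (h s)) \<le> R"
      unfolding h_def
    proof (rule twisted_bound_outside_circle[OF _ _ injv circ \<epsilon>(1)])
      show "v holomorphic_on ball 0 1" unfolding v_def by (intro holomorphic_intros hol)
    qed (use u0 expQ[OF s] s1 in \<open>auto simp: v_def\<close>)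
    have v': "(v has_field_derivative (deriv u (exp s) - b 1)) (at (exp s))"
      unfolding v_def by (auto intro!: derivative_eq_intros du s1)
    have "((\<lambda>s. v (exp s)) has_field_derivative (deriv u (exp s) - b 1) * exp s) (at s)"
      by (rule DERIV_chain2[where f = v and g = exp, OF v' DERIV_exp])
    from DERIV_divide[OF this DERIV_exp exp_not_eq_zero]
    have "(h has_field_derivative ((deriv u (exp s) - b 1) * exp s * exp s - v (exp s) * exp s) / (exp s * exp s)) (at s)"
      by (simp add: h_def[abs_def])
    moreover have "((deriv u (exp s) - b 1) * exp s * exp s - v (exp s) * exp s) / (exp s * exp s) = h' s"
      by (simp add: h'_def p_def v_def divide_simps) (simp add: algebra_simps)
    ultimately show "(h has_field_derivative h' s) (at s)" by simp
  next
    show "inj_on h {s. ln \<epsilon> < Re s \<and> Re s < ln \<rho> \<and> 0 < Im s \<and> Im s < 2 * pi}"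
    proof (rule inj_onI, fold Q_def)
      fix s t assume st: "s \<in> Q" "t \<in> Q" "h s = h t"
      have "exp s = exp t"
        using injv[THEN inj_onD, of "exp s" "exp t"] st expQ1 by (simp add: h_def)
      then show "s = t"
        by (rule exp_complex_eqI[rotated]) (use st in \<open>auto simp: Q_def\<close>)
    qed
  qed (use \<beta> in auto)
  \<comment> \<open>The coefficients of \<open>p\<close> are \<open>(n - 1) * b n\<close>, so \<open>g x\<close> is the Bessel lower bound for the
      integral of \<open>|h'|\<^sup>2 = |p|\<^sup>2 / |exp s|\<^sup>2\<close> over the segment \<open>Re s = x\<close>; \<open>G\<close> is its primitive.\<close>
  define g where "g = (\<lambda>x. 2 * pi * (exp (- 2 * x) + (\<Sum>k<N. (real k)\<^sup>2 * (cmod (b (Suc k)))\<^sup>2 * exp (2 * real k * x))))"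
  define G where "G = (\<lambda>x. pi * (- exp (- 2 * x) + (\<Sum>k<N. real k * (cmod (b (Suc k)))\<^sup>2 * exp (2 * real k * x))))"
  have gI: "g x \<le> I x" if x: "x \<le> ln \<rho>" for x
  proof -
    have x0: "x < 0" using x \<rho> \<rho>0 ln_less_zero by (meson order_le_less_trans)
    have "2 * pi * (\<Sum>n<Suc N. (cmod ((of_nat n - 1) * b n))\<^sup>2 * exp x ^ (2 * n))
        \<le> integral {0..2*pi} (\<lambda>y. (cmod (p (of_real (exp x) * cis y)))\<^sup>2)"
      using x0 by (intro bessel_circle p_sums) auto
    then have "exp (- 2 * x) * (2 * pi * (\<Sum>n<Suc N. (cmod ((of_nat n - 1) * b n))\<^sup>2 * exp x ^ (2 * n)))
        \<le> exp (- 2 * x) * integral {0..2*pi} (\<lambda>y. (cmod (p (of_real (exp x) * cis y)))\<^sup>2)"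
      by (intro mult_left_mono) auto
    also have "\<dots> = I x"
    proof -
      have "(cmod (h' (Complex x y)))\<^sup>2 = exp (- 2 * x) * (cmod (p (of_real (exp x) * cis y)))\<^sup>2" for y
      proof -
        have e: "exp (Complex x y) = of_real (exp x) * cis y"
          using exp_eq_polar[of "Complex x y"] by simp
        have e2: "1 / (exp x)\<^sup>2 = exp (- 2 * x)"
          using exp_double[of x] by (simp add: exp_minus inverse_eq_divide)
        have "(cmod (h' (Complex x y)))\<^sup>2 = (cmod (p (of_real (exp x) * cis y)))\<^sup>2 * (1 / (exp x)\<^sup>2)"
          unfolding h'_def e by (simp add: norm_divide norm_mult power_divide)
        then show ?thesis unfolding e2 by (simp only: mult.commute)
      qed
      then show ?thesis by (simp add: I_def)
    qed
    finally have "exp (- 2 * x) * (2 * pi * (\<Sum>n<Suc N. (cmod ((of_nat n - 1) * b n))\<^sup>2 * exp x ^ (2 * n))) \<le> I x" .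
    moreover have "exp (- 2 * x) * (2 * pi * (\<Sum>n<Suc N. (cmod ((of_nat n - 1) * b n))\<^sup>2 * exp x ^ (2 * n))) = g x"
    proof -
      let ?T = "\<lambda>k. (real k)\<^sup>2 * (cmod (b (Suc k)))\<^sup>2 * exp x ^ (2 * Suc k)"
      have head: "(\<Sum>n<Suc N. (cmod ((of_nat n - 1) * b n))\<^sup>2 * exp x ^ (2 * n)) = 1 + (\<Sum>k<N. ?T k)"
        unfolding sum.lessThan_Suc_shift by (simp add: b0 norm_mult power_mult_distrib)
      have shift: "exp (- 2 * x) * ?T k = (real k)\<^sup>2 * (cmod (b (Suc k)))\<^sup>2 * exp (2 * real k * x)" for k
      proof -
        have "exp (- 2 * x) * ?T k = (real k)\<^sup>2 * (cmod (b (Suc k)))\<^sup>2 * (exp (- 2 * x) * exp x ^ (2 * Suc k))"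
          by (simp only: mult_ac)
        also have "exp (- 2 * x) * exp x ^ (2 * Suc k) = exp (2 * real k * x)"
          by (simp only: exp_of_nat_mult[symmetric] exp_add[symmetric]) (simp add: algebra_simps)
        finally show ?thesis .
      qed
      have "exp (- 2 * x) * (2 * pi * (1 + X)) = 2 * pi * (exp (- 2 * x) + exp (- 2 * x) * X)" for X
        by (simp add: algebra_simps)
      then show ?thesis
        unfolding head g_def shift[symmetric] sum_distrib_left[symmetric] .
    qed
    ultimately show ?thesis by simp
  qed
  have gint: "(g has_integral (G (ln \<rho>) - G (ln \<epsilon>))) {ln \<epsilon>..ln \<rho>}"
  proof (rule fundamental_theorem_of_calculus)
    fix x
    have "(G has_real_derivative g x) (at x within {ln \<epsilon>..ln \<rho>})"
      unfolding G_def g_def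
      by (rule derivative_eq_intros refl)+
         (auto simp: sum_distrib_left algebra_simps power2_eq_square)
    then show "(G has_vector_derivative g x) (at x within {ln \<epsilon>..ln \<rho>})"
      by (simp add: has_real_derivative_iff_has_vector_derivative)
  qed (use \<epsilon> \<rho> in auto)
  have "G (ln \<rho>) - G (ln \<epsilon>) \<le> integral {ln \<epsilon>..ln \<rho>} I"
  proof -
    have "continuous_on {ln \<epsilon>..ln \<rho>} I"
      unfolding I_def cbox_interval[symmetric]
      by (rule integral_continuous_on_param) (use cont in \<open>simp add: cbox_Pair_eq\<close>)
    then have "I integrable_on {ln \<epsilon>..ln \<rho>}" by (rule integrable_continuous_interval)
    then show ?thesis
      using integral_le[of g "{ln \<epsilon>..ln \<rho>}" I] gint gI integral_unique[OF gint] by force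
  qed
  \<comment> \<open>\<open>R\<close> contains the factor \<open>\<delta>\<close>, hence the bound \<open>pi * R\<^sup>2\<close> has \<open>\<delta>\<^sup>2\<close>: one factor
      cancels the determinant, the other is at most \<open>1\<close>.\<close>
  also have "\<dots> \<le> pi * (1 / \<epsilon> + 4 * K * \<epsilon>\<^sup>2)\<^sup>2"
  proof -
    have "\<delta> * integral {ln \<epsilon>..ln \<rho>} I \<le> \<delta> * (\<delta> * (pi * (1 / \<epsilon> + 4 * K * \<epsilon>\<^sup>2)\<^sup>2))"
      using upper by (simp add: R_def power_mult_distrib power2_eq_square mult_ac)
    then have "integral {ln \<epsilon>..ln \<rho>} I \<le> \<delta> * (pi * (1 / \<epsilon> + 4 * K * \<epsilon>\<^sup>2)\<^sup>2)"
      using \<delta> by simp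
    also have "\<dots> \<le> 1 * (pi * (1 / \<epsilon> + 4 * K * \<epsilon>\<^sup>2)\<^sup>2)"
      using \<delta> by (intro mult_right_mono) auto
    finally show ?thesis by simp
  qed
  also have "(1 / \<epsilon> + 4 * K * \<epsilon>\<^sup>2)\<^sup>2 = 1 / \<epsilon>\<^sup>2 + 8 * K * \<epsilon> + 16 * K\<^sup>2 * \<epsilon> ^ 4"
    using \<epsilon> by (simp add: field_simps power2_eq_square power4_eq_xxxx)
  finally have main: "G (ln \<rho>) - G (ln \<epsilon>) \<le> pi * (1 / \<epsilon>\<^sup>2 + 8 * K * \<epsilon> + 16 * K\<^sup>2 * \<epsilon> ^ 4)" .
  have G: "G (ln t) = pi * (- 1 / t\<^sup>2 + (\<Sum>k<N. real k * (cmod (b (Suc k)))\<^sup>2 * t ^ (2 * k)))" if t: "0 < t" for t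
  proof -
    have "exp (- 2 * ln t) = 1 / t\<^sup>2"
      using t by (simp add: exp_minus exp_double inverse_eq_divide)
    moreover have "exp (2 * real k * ln t) = t ^ (2 * k)" for k
      using t exp_of_nat_mult[of "2 * k" "ln t"] by simp
    ultimately show ?thesis by (simp add: G_def)
  qed
  have "G (ln \<rho>) - G (ln \<epsilon>) = pi * (1 / \<epsilon>\<^sup>2 - 1 / \<rho>\<^sup>2 +
      (\<Sum>n<N. real n * (cmod (b (Suc n)))\<^sup>2 * (\<rho> ^ (2 * n) - \<epsilon> ^ (2 * n))))"
    unfolding G[OF \<epsilon>(1)] G[OF \<rho>0] right_diff_distrib sum_subtractf by (simp add: algebra_simps)
  with main show ?thesis by simp
qed

text \<open>Gronwall's theorem for \<open>g z = u z / z = 1 / z + b 1 + b 2 * z + \<dots>\<close>: let \<open>\<epsilon>\<close> tend to \<open>0\<close>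
  and then \<open>\<rho>\<close> to \<open>1\<close> in the annulus estimate.\<close>

theorem area_theorem:
  fixes b :: "nat \<Rightarrow> complex"
  assumes sums: "\<And>z. cmod z < 1 \<Longrightarrow> (\<lambda>n. b n * z ^ n) sums u z" and u0: "u 0 = 1"
    and inj: "inj_on (\<lambda>z. u z / z) (ball 0 1 - {0})"
  shows "(\<Sum>n<N. real n * (cmod (b (Suc n)))\<^sup>2) \<le> 1"
proof -
  define c where "c = (\<lambda>n. real n * (cmod (b (Suc n)))\<^sup>2)"
  have b0: "b 0 = 1"
    using sums[of 0] u0 by (simp add: powser_sums_zero_iff)
  \<comment> \<open>Splitting off three terms exhibits the cubic Taylor remainder.\<close>
  obtain q where q: "\<And>z. cmod z < 1 \<Longrightarrow> (\<lambda>n. b (Suc n) * z ^ n) sums q z"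
    and uq: "\<And>z. cmod z < 1 \<Longrightarrow> u z = b 0 + z * q z"
    using power_series_split_head[OF sums] by metis
  obtain q' where q': "\<And>z. cmod z < 1 \<Longrightarrow> (\<lambda>n. b (Suc (Suc n)) * z ^ n) sums q' z"
    and qq': "\<And>z. cmod z < 1 \<Longrightarrow> q z = b (Suc 0) + z * q' z"
    using power_series_split_head[OF q] by metis
  obtain k where k: "\<And>z. cmod z < 1 \<Longrightarrow> (\<lambda>n. b (Suc (Suc (Suc n))) * z ^ n) sums k z"
    and qk: "\<And>z. cmod z < 1 \<Longrightarrow> q' z = b (Suc (Suc 0)) + z * k z"
    using power_series_split_head[OF q'] by metis
  have "continuous_on (cball 0 (1/2)) k"
    by (rule continuous_on_subset[OF holomorphic_on_imp_continuous_on[OF power_series_holomorphic_unit[OF k]]]) auto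
  then have "bounded (k ` cball 0 (1/2))"
    by (intro compact_imp_bounded compact_continuous_image) auto
  then obtain K where K: "\<And>z. cmod z \<le> 1/2 \<Longrightarrow> cmod (k z) \<le> K"
    unfolding bounded_iff by force
  have rem: "cmod (u z - (1 + b 1 * z + b 2 * z\<^sup>2)) \<le> K * cmod z ^ 3" if z: "cmod z \<le> 1 / 2" for z
  proof -
    have "u z - (1 + b 1 * z + b 2 * z\<^sup>2) = k z * z ^ 3"
      using z by (simp add: uq qq' qk b0 algebra_simps numeral_eq_Suc)
    then show ?thesis using K[OF z] by (simp add: norm_mult norm_power mult_right_mono)
  qed
  have at_\<rho>: "(\<Sum>n<N. c n * \<rho> ^ (2 * n)) \<le> 1 / \<rho>\<^sup>2" if \<rho>: "0 < \<rho>" "\<rho> < 1" for \<rho>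
  proof -
    have "((\<lambda>\<epsilon>::real. cmod (b 2) * \<epsilon>\<^sup>2) \<longlongrightarrow> cmod (b 2) * 0\<^sup>2) (at_right 0)"
      by (intro tendsto_intros)
    then have "\<forall>\<^sub>F \<epsilon> in at_right 0. cmod (b 2) * \<epsilon>\<^sup>2 < 1 / 2"
      by (rule order_tendstoD) simp
    moreover have "\<forall>\<^sub>F \<epsilon> in at_right (0::real). 0 < \<epsilon> \<and> \<epsilon> < min \<rho> (1/2)"
      using eventually_at_right_real[of 0 "min \<rho> (1/2)"] \<rho> by simp
    ultimately have "\<forall>\<^sub>F \<epsilon> in at_right 0. (\<Sum>n<N. c n * (\<rho> ^ (2 * n) - \<epsilon> ^ (2 * n))) 
        \<le> 1 / \<rho>\<^sup>2 + 8 * K * \<epsilon> + 16 * K\<^sup>2 * \<epsilon> ^ 4"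
      by eventually_elim
         (unfold c_def, rule area_theorem_annulus[OF sums u0 inj rem], use \<rho> in auto)
    moreover have "((\<lambda>\<epsilon>. \<Sum>n<N. c n * (\<rho> ^ (2 * n) - \<epsilon> ^ (2 * n))) \<longlongrightarrow>
        (\<Sum>n<N. c n * (\<rho> ^ (2 * n) - 0 ^ (2 * n)))) (at_right 0)"
      by (intro tendsto_intros)
    moreover have "((\<lambda>\<epsilon>. 1 / \<rho>\<^sup>2 + 8 * K * \<epsilon> + 16 * K\<^sup>2 * \<epsilon> ^ 4) \<longlongrightarrow> 
        1 / \<rho>\<^sup>2 + 8 * K * 0 + 16 * K\<^sup>2 * 0 ^ 4) (at_right 0)"
      by (intro tendsto_intros)
    ultimately have "(\<Sum>n<N. c n * (\<rho> ^ (2 * n) - 0 ^ (2 * n))) \<le> 1 / \<rho>\<^sup>2 + 8 * K * 0 + 16 * K\<^sup>2 * 0 ^ 4"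
      by (intro tendsto_le[OF trivial_limit_at_right_real])
    moreover have "c n * (\<rho> ^ (2 * n) - 0 ^ (2 * n)) = c n * \<rho> ^ (2 * n)" for n
      by (cases n) (auto simp: c_def)
    ultimately show ?thesis by simp
  qed
  have "\<forall>\<^sub>F \<rho> in at_left (1::real). (\<Sum>n<N. c n * \<rho> ^ (2 * n)) \<le> 1 / \<rho>\<^sup>2"
    using eventually_at_left_real[of 0 1, OF zero_less_one] by eventually_elim (use at_\<rho> in auto)
  moreover have "((\<lambda>\<rho>. \<Sum>n<N. c n * \<rho> ^ (2 * n)) \<longlongrightarrow> (\<Sum>n<N. c n * 1 ^ (2 * n))) (at_left 1)"
    by (intro tendsto_intros)
  moreover have "((\<lambda>\<rho>. 1 / \<rho>\<^sup>2) \<longlongrightarrow> 1 / 1\<^sup>2) (at_left (1::real))"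
    by (intro tendsto_intros) auto
  ultimately have "(\<Sum>n<N. c n * 1 ^ (2 * n)) \<le> 1 / 1\<^sup>2"
    by (intro tendsto_le[OF trivial_limit_at_left_real])
  then show ?thesis by (simp add: c_def)
qed

section \<open>The reciprocal of a univalent function and averages of coefficients\<close>

text \<open>What the area theorem needs from \<open>f\<close>: the quotient \<open>z / f z\<close> extends holomorphically over \<open>0\<close>, and
  divided by \<open>z\<close> it is \<open>1 / f\<close>, which inherits injectivity. Its linear coefficient comes from
  differentiating \<open>z_over f z * f z = z\<close> twice at \<open>0\<close>.\<close>

lemma z_over_class_S:
  assumes f: "f \<in> class_S"
  shows "z_over f holomorphic_on unit_disk"
    and "inj_on (\<lambda>z. z_over f z / z) (unit_disk - {0})"
    and "deriv (z_over f) 0 = - ((deriv ^^ 2) f 0 / 2)"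
proof -
  have hol: "f holomorphic_on unit_disk" and f0: "f 0 = 0" and f'0: "deriv f 0 = 1"
    and inj: "inj_on f unit_disk"
    using f by (auto simp: class_S_def class_A_def univalent_on_def)
  have nz: "f z \<noteq> 0" if "z \<in> unit_disk" "z \<noteq> 0" for z
    using inj_onD[OF inj, of z 0] that f0 by auto
  define q where "q = (\<lambda>z. if z = 0 then 1 else f z / z)"
  have "q holomorphic_on unit_disk"
    by (rule pole_theorem_0[OF hol, of 0]) (auto simp: q_def f0 f'0)
  moreover have "q z \<noteq> 0" if "z \<in> unit_disk" for z
    using nz[OF that] by (simp add: q_def)
  ultimately have "(\<lambda>z. 1 / q z) holomorphic_on unit_disk"
    by (intro holomorphic_intros)
  moreover have "1 / q z = z_over f z" for z
    by (simp add: q_def z_over_def)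
  ultimately show u: "z_over f holomorphic_on unit_disk" by simp
  have "z_over f z / z = 1 / f z" if "z \<in> unit_disk - {0}" for z
    using that by (simp add: z_over_def)
  then show "inj_on (\<lambda>z. z_over f z / z) (unit_disk - {0})"
    using inj by (auto simp: inj_on_def)
  have mult: "z_over f z * f z = z" if "z \<in> unit_disk" for z
    using nz[OF that] f0 by (simp add: z_over_def)
  have "(deriv ^^ 2) (\<lambda>z. z_over f z * f z) 0 = (deriv ^^ 2) (\<lambda>z. z) (0 :: complex)"
    by (rule higher_deriv_transform_within_open[where S = unit_disk])
       (use mult in \<open>auto intro!: holomorphic_intros u hol\<close>)
  moreover have "(deriv ^^ 2) (\<lambda>z. z) (0 :: complex) = 0"
    by (simp add: numeral_2_eq_2)
  moreover have "(deriv ^^ 2) (\<lambda>z. z_over f z * f z) 0 = (deriv ^^ 2) f 0 + 2 * deriv (z_over f) 0"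
    by (subst higher_deriv_mult[OF u hol])
       (simp_all add: numeral_2_eq_2 z_over_def f0 f'0)
  ultimately show "deriv (z_over f) 0 = - ((deriv ^^ 2) f 0 / 2)"
    by (simp add: eq_neg_iff_add_eq_0 field_simps)
qed

text \<open>Convexity of the squared modulus: it lets the area bound pass to averages.\<close>

lemma cmod_average_square_le:
  fixes w :: "nat \<Rightarrow> complex"
  assumes "m \<ge> 1"
  shows "(cmod (1 / of_nat m * (\<Sum>k=1..m. w k)))\<^sup>2 \<le> 1 / real m * (\<Sum>k=1..m. (cmod (w k))\<^sup>2)"
proof -
  have "(cmod (\<Sum>k=1..m. w k))\<^sup>2 \<le> (\<Sum>k=1..m. cmod (w k))\<^sup>2"
    by (intro power_mono norm_sum) auto
  also have "\<dots> \<le> (\<Sum>k=1..m. (cmod (w k))\<^sup>2) * m"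
    using sum_squared_le_sum_of_squares[of "\<lambda>k. cmod (w k)" "{1..m}"] by simp
  finally have "(cmod (\<Sum>k=1..m. w k))\<^sup>2 / (real m)\<^sup>2 \<le> (\<Sum>k=1..m. (cmod (w k))\<^sup>2) * m / (real m)\<^sup>2"
    by (rule divide_right_mono) auto
  then show ?thesis
    using assms by (simp add: norm_mult norm_divide power_divide power2_eq_square)
qed

section \<open>Univalence and starlikeness from the area bound\<close>

lemma square_ratio_less:
  fixes t l :: real
  assumes "0 \<le> t" "0 < l" "t < sqrt (l / (1 + l))"
  shows "t\<^sup>2 / (1 - t\<^sup>2) < l"
proof -
  have "t\<^sup>2 < (sqrt (l / (1 + l)))\<^sup>2"
    using assms by (intro power_strict_mono) auto
  then have t: "t\<^sup>2 < l / (1 + l)" using assms by simp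
  then have "t\<^sup>2 < 1" using assms by (smt (verit) divide_less_eq_1_pos)
  then show ?thesis using t assms by (simp add: field_simps)
qed

lemma sqrt_ratio_le:
  fixes l :: real
  assumes "0 < l" "l \<le> 1"
  shows "sqrt (l / (1 + l)) \<le> 1 / sqrt 2"
proof -
  have "l / (1 + l) \<le> 1 / 2" using assms by (simp add: field_simps)
  then have "sqrt (l / (1 + l)) \<le> sqrt (1 / 2)" by (rule real_sqrt_le_mono)
  then show ?thesis by (simp add: real_sqrt_divide)
qed

text \<open>The area bound is an assumption here because the average \<open>F\<close> need not be univalent in the whole
  disk, so that the area theorem does not apply to \<open>F\<close> itself.\<close>

locale area_bounded_quotient =
  fixes u :: "complex \<Rightarrow> complex" and b :: "nat \<Rightarrow> complex" and F :: "complex \<Rightarrow> complex"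
  assumes sums: "\<And>z. cmod z < 1 \<Longrightarrow> (\<lambda>n. b n * z ^ n) sums u z"
    and u0: "u 0 = 1"
    and nz: "\<And>z. cmod z < 1 \<Longrightarrow> u z \<noteq> 0"
    and area: "\<And>N. (\<Sum>n<N. real (Suc n) * (cmod (b (Suc (Suc n))))\<^sup>2) \<le> 1"
    and F: "\<And>z. cmod z < 1 \<Longrightarrow> F z = z / u z"
begin

lemma b0: "b 0 = 1"
  using sums[of 0] u0 by (simp add: powser_sums_zero_iff)

text \<open>The terms \<open>n = 0\<close> and \<open>n = 1\<close> of \<open>\<Sum> (n - 1) * b n * z ^ n\<close> need separate care (the weight is
  negative, respectively zero), so \<open>tail t\<close> majorises the sum over \<open>n \<ge> 2\<close>, with indices shifted
  by two.\<close>

definition tail :: "real \<Rightarrow> real" where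
  "tail t = (\<Sum>n. real (Suc n) * cmod (b (Suc (Suc n))) * t ^ Suc (Suc n))"

text \<open>Cauchy-Schwarz with the weights \<open>n - 1\<close> split evenly between the two factors, since
  \<open>\<Sum> (n - 1) * t ^ (2 * n) = (t\<^sup>2 / (1 - t\<^sup>2))\<^sup>2\<close>.\<close>

lemma tail_partial_sum_le:
  assumes t: "0 \<le> t" "t < 1"
  shows "(\<Sum>n<N. real (Suc n) * cmod (b (Suc (Suc n))) * t ^ Suc (Suc n)) \<le> t\<^sup>2 / (1 - t\<^sup>2)"
proof -
  let ?x = "\<lambda>n. sqrt (real (Suc n)) * cmod (b (Suc (Suc n)))"
  let ?y = "\<lambda>n. sqrt (real (Suc n)) * t ^ Suc (Suc n)"
  have t2: "t\<^sup>2 < 1" using t by (simp add: power_less_one_iff)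
  have geom: "(\<lambda>n. real (Suc n) * (t\<^sup>2) ^ n) sums (1 / (1 - t\<^sup>2)\<^sup>2)"
    using geometric_deriv_sums[of "t\<^sup>2"] t2 by simp
  have "(\<Sum>n<N. real (Suc n) * (t\<^sup>2) ^ n) \<le> 1 / (1 - t\<^sup>2)\<^sup>2"
    using sum_le_suminf[OF sums_summable[OF geom], of "{..<N}"] sums_unique[OF geom] t by simp
  then have "t ^ 4 * (\<Sum>n<N. real (Suc n) * (t\<^sup>2) ^ n) \<le> t ^ 4 * (1 / (1 - t\<^sup>2)\<^sup>2)"
    by (intro mult_left_mono) auto
  moreover have "(\<Sum>n<N. (?y n)\<^sup>2) = t ^ 4 * (\<Sum>n<N. real (Suc n) * (t\<^sup>2) ^ n)"
  proof -
    have "(t ^ Suc (Suc n))\<^sup>2 = t ^ 4 * (t\<^sup>2) ^ n" for n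
      by (simp only: power_mult[symmetric] power_add[symmetric]) (rule arg_cong[where f = "power t"], simp)
    then show ?thesis
      unfolding sum_distrib_left by (simp add: power_mult_distrib mult_ac del: power_Suc)
  qed
  ultimately have y: "(\<Sum>n<N. (?y n)\<^sup>2) \<le> (t\<^sup>2 / (1 - t\<^sup>2))\<^sup>2"
    by (simp add: power_divide flip: power_mult)
  have "(\<Sum>n<N. ?x n * ?y n)\<^sup>2 \<le> (\<Sum>n<N. (?x n)\<^sup>2) * (\<Sum>n<N. (?y n)\<^sup>2)"
    by (rule Cauchy_Schwarz_ineq_sum)
  also have "(\<Sum>n<N. (?x n)\<^sup>2) = (\<Sum>n<N. real (Suc n) * (cmod (b (Suc (Suc n))))\<^sup>2)"
    by (simp add: power_mult_distrib)
  also have "\<dots> * (\<Sum>n<N. (?y n)\<^sup>2) \<le> 1 * (t\<^sup>2 / (1 - t\<^sup>2))\<^sup>2"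
    using area y by (intro mult_mono) (auto intro: sum_nonneg)
  finally have "(\<Sum>n<N. ?x n * ?y n)\<^sup>2 \<le> (t\<^sup>2 / (1 - t\<^sup>2))\<^sup>2" by simp
  then have "(\<Sum>n<N. ?x n * ?y n) \<le> t\<^sup>2 / (1 - t\<^sup>2)"
    by (rule power2_le_imp_le) (use t2 in auto)
  moreover have "?x n * ?y n = real (Suc n) * cmod (b (Suc (Suc n))) * t ^ Suc (Suc n)" for n
  proof -
    have "?x n * ?y n = (sqrt (real (Suc n)) * sqrt (real (Suc n))) * cmod (b (Suc (Suc n))) * t ^ Suc (Suc n)"
      by (simp only: mult_ac)
    then show ?thesis by simp
  qed
  ultimately show ?thesis by (simp only:)
qed

lemma tail_sums:
  assumes "0 \<le> t" "t < 1"
  shows "(\<lambda>n. real (Suc n) * cmod (b (Suc (Suc n))) * t ^ Suc (Suc n)) sums tail t"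
  unfolding tail_def
  by (rule summable_sums, rule summableI_nonneg_bounded[where x = "t\<^sup>2 / (1 - t\<^sup>2)"])
     (use assms tail_partial_sum_le in auto)

lemma tail_le:
  assumes "0 \<le> t" "t < 1"
  shows "tail t \<le> t\<^sup>2 / (1 - t\<^sup>2)"
  unfolding tail_def
  by (rule suminf_le_const[OF sums_summable[OF tail_sums[OF assms]] tail_partial_sum_le[OF assms]])

lemma tail_less:
  assumes "0 \<le> t" "0 < l" "t < sqrt (l / (1 + l))"
  shows "tail t < l"
proof -
  have "sqrt (l / (1 + l)) < 1" using assms by simp
  then show ?thesis
    using tail_le[of t] square_ratio_less[OF assms] assms by linarith
qed

lemma cmod_le_majorant:
  assumes s: "(\<lambda>n. c n * b (Suc (Suc n)) * z ^ Suc (Suc n)) sums w"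
    and c: "\<And>n. cmod (c n) = d n" and d: "(\<lambda>n. d n * cmod (b (Suc (Suc n))) * cmod z ^ Suc (Suc n)) sums x"
  shows "cmod w \<le> x"
proof -
  have "norm (c n * b (Suc (Suc n)) * z ^ Suc (Suc n)) = d n * cmod (b (Suc (Suc n))) * cmod z ^ Suc (Suc n)" for n
    using c by (simp add: norm_mult norm_power)
  then show ?thesis
    using norm_sums_le[OF s d] by simp
qed

lemma quadratic_part_sums:
  assumes z: "cmod z < 1"
  shows "(\<lambda>n. b (Suc (Suc n)) * z ^ Suc (Suc n)) sums (u z - 1 - b 1 * z)"
    and "(\<lambda>n. of_nat (Suc n) * b (Suc (Suc n)) * z ^ Suc (Suc n)) sums (z * deriv u z - u z + 1)"
proof -
  have "(\<lambda>n. b (Suc (Suc n)) * z ^ Suc (Suc n)) sums (u z - b 0 * z ^ 0 - b (Suc 0) * z ^ Suc 0)"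
    using sums[OF z] unfolding sums_Suc_iff[of "\<lambda>n. b (Suc n) * z ^ Suc n"] sums_Suc_iff[of "\<lambda>n. b n * z ^ n"] 
    by (simp add: algebra_simps)
  then show 1: "(\<lambda>n. b (Suc (Suc n)) * z ^ Suc (Suc n)) sums (u z - 1 - b 1 * z)"
    by (simp add: b0)
  have "(\<lambda>n. of_nat (Suc (Suc n)) * b (Suc (Suc n)) * z ^ Suc (Suc n)) sums (z * deriv u z - b 1 * z)"
    using power_series_euler[OF sums z]
    unfolding sums_Suc_iff[of "\<lambda>n. of_nat (Suc n) * b (Suc n) * z ^ Suc n"] sums_Suc_iff[of "\<lambda>n. of_nat n * b n * z ^ n"]
    by (simp add: algebra_simps)
  from sums_diff[OF this 1] show "(\<lambda>n. of_nat (Suc n) * b (Suc (Suc n)) * z ^ Suc (Suc n)) sums (z * deriv u z - u z + 1)"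
    by (simp add: algebra_simps)
qed

lemma u_holomorphic: "u holomorphic_on unit_disk"
  by (rule power_series_holomorphic_unit[OF sums])

lemma F_deriv:
  assumes z: "cmod z < 1"
  shows "(F has_field_derivative (u z - z * deriv u z) / (u z)\<^sup>2) (at z)"
proof (rule has_field_derivative_transform_within_open[where S = unit_disk])
  have "(u has_field_derivative deriv u z) (at z)"
    using holomorphic_derivI[OF u_holomorphic open_ball] z by simp
  then show "((\<lambda>z. z / u z) has_field_derivative (u z - z * deriv u z) / (u z)\<^sup>2) (at z)"
    using nz[OF z] by (auto intro!: derivative_eq_intros simp: power2_eq_square)
qed (use F z in auto)

lemma F_holomorphic: "F holomorphic_on unit_disk"
  unfolding holomorphic_on_open[OF open_ball] by (meson F_deriv mem_ball_0)

text \<open>Since \<open>F' = (u - z * u') / u\<^sup>2\<close>, the quantity in \<open>class_U\<close> is \<open>u - z * u' - 1\<close>, the power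
  series with coefficients \<open>-(n - 1) * b n\<close>.\<close>

lemma defect_le:
  assumes z: "cmod z < 1"
  shows "cmod (deriv F z * (u z)\<^sup>2 - 1) \<le> tail (cmod z)"
proof -
  have "deriv F z * (u z)\<^sup>2 - 1 = - (z * deriv u z - u z + 1)"
    using nz[OF z] by (simp add: DERIV_imp_deriv[OF F_deriv[OF z]])
  moreover have "cmod (z * deriv u z - u z + 1) \<le> tail (cmod z)"
    by (rule cmod_le_majorant[OF quadratic_part_sums(2)[OF z] _ tail_sums]) (use z in \<open>auto simp del: of_nat_Suc\<close>)
  ultimately show ?thesis by (metis norm_minus_cancel)
qed

text \<open>\<open>F x = F y\<close> means \<open>x * u y = y * u x\<close>. The linear terms of \<open>u\<close> cancel and the
  constant ones give \<open>x - y\<close>, so \<open>y - x = \<Sum> b n * x * y * (y ^ (n - 1) - x ^ (n - 1))\<close> over \<open>n \<ge> 2\<close>,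
  which is at most \<open>tail t * |y - x|\<close> for \<open>t = max |x| |y|\<close>; and \<open>tail t < 1\<close> for \<open>t < 1 / sqrt 2\<close>.\<close>

lemma F_inj_on: "inj_on F (ball 0 (1 / sqrt 2))"
proof (rule inj_onI)
  fix x y assume xy: "x \<in> ball 0 (1 / sqrt 2)" "y \<in> ball 0 (1 / sqrt 2)" "F x = F y"
  have half: "1 / sqrt 2 = sqrt (1 / (1 + 1))" by (simp add: real_sqrt_divide)
  have "1 / sqrt 2 < (1::real)" by simp
  with xy have x1: "cmod x < 1" and y1: "cmod y < 1"
    by (meson less_trans mem_ball_0)+
  have eq: "x * u y = y * u x" 
    using xy(3) nz[OF x1] nz[OF y1] by (simp add: F x1 y1 field_simps)
  show "x = y"
  proof (rule ccontr)
    assume ne: "x \<noteq> y"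
    define t where "t = max (cmod x) (cmod y)"
    have t0: "0 < t" using ne by (auto simp: t_def less_max_iff_disj)
    have t1: "t < 1" using x1 y1 by (simp add: t_def)
    have t2: "t < sqrt (1 / (1 + 1))" using xy unfolding half[symmetric] by (simp add: t_def)
    \<comment> \<open>The power difference estimate holds in the closed unit disk, hence the scaling by \<open>t\<close> below.\<close>
    let ?d = "\<lambda>n. b (Suc (Suc n)) * (x * y ^ Suc (Suc n) - y * x ^ Suc (Suc n))"
    have "?d sums (x * (u y - 1 - b 1 * y) - y * (u x - 1 - b 1 * x))"
      using sums_diff[OF sums_mult[OF quadratic_part_sums(1)[OF y1], of x]
          sums_mult[OF quadratic_part_sums(1)[OF x1], of y]]
      by (simp add: algebra_simps)
    then have s: "?d sums (y - x)"
      using eq by (simp add: algebra_simps)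
    have bound: "cmod (?d n) \<le> real (Suc n) * cmod (b (Suc (Suc n))) * t ^ Suc (Suc n) * cmod (y - x)" for n
    proof -
      have "cmod ((y / t) ^ Suc n - (x / t) ^ Suc n) \<le> real (Suc n) * cmod (y / t - x / t)"
        by (rule norm_power_diff) (use t0 in \<open>auto simp: norm_divide t_def\<close>)
      then have "t ^ Suc n * cmod ((y / t) ^ Suc n - (x / t) ^ Suc n) \<le> t ^ Suc n * (real (Suc n) * cmod (y / t - x / t))"
        using t0 by (intro mult_left_mono) auto
      moreover have "cmod (y / t - x / t) = cmod (y - x) / t"
        using t0 by (simp add: norm_divide flip: diff_divide_distrib)
      moreover have "t ^ Suc n * cmod ((y / t) ^ Suc n - (x / t) ^ Suc n) = cmod (y ^ Suc n - x ^ Suc n)"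
      proof -
        have "(y / t) ^ Suc n - (x / t) ^ Suc n = (y ^ Suc n - x ^ Suc n) / of_real (t ^ Suc n)"
          by (simp only: power_divide diff_divide_distrib of_real_power)
        then show ?thesis using t0 by (simp only: norm_divide norm_of_real) (simp add: norm_mult norm_power)
      qed
      ultimately have "cmod (y ^ Suc n - x ^ Suc n) \<le> t ^ Suc n * (real (Suc n) * (cmod (y - x) / t))"
        by (simp only:)
      also have "\<dots> = real (Suc n) * t ^ n * cmod (y - x)"
        using t0 by simp
      finally have pow: "cmod (y ^ Suc n - x ^ Suc n) \<le> real (Suc n) * t ^ n * cmod (y - x)" .
      have "?d n = b (Suc (Suc n)) * (x * y) * (y ^ Suc n - x ^ Suc n)"
        by (simp add: algebra_simps)
      then have "cmod (?d n) = cmod (b (Suc (Suc n))) * (cmod x * cmod y) * cmod (y ^ Suc n - x ^ Suc n)"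
        by (simp only: norm_mult)
      also have "\<dots> \<le> cmod (b (Suc (Suc n))) * (t * t) * (real (Suc n) * t ^ n * cmod (y - x))"
        using pow t0 by (intro mult_mono) (auto simp: t_def)
      finally show ?thesis by (simp add: mult_ac)
    qed
    have "cmod (y - x) \<le> tail t * cmod (y - x)"
      by (rule norm_sums_le[OF s _ bound]) (intro sums_mult2 tail_sums, use t0 t1 in auto)
    moreover have "tail t < 1" using tail_less[of t 1] t0 t2 by simp
    ultimately show False using ne by simp
  qed
qed

text \<open>Here \<open>z * F' / F = 1 - q\<close> with \<open>q = z * u' / u\<close>, and \<open>Re q < 1\<close> says that \<open>q\<close> is closer to \<open>0\<close>
  than to \<open>2\<close>, i.e. \<open>|z * u'| < |2 * u - z * u'|\<close>. The series are
  \<open>b 1 * z + \<Sum> n * b n * z ^ n\<close> and \<open>2 + b 1 * z - \<Sum> (n - 2) * b n * z ^ n\<close> over \<open>n \<ge> 2\<close>; as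
  \<open>n + (n - 2) = 2 * (n - 1)\<close>, the two sums together cost \<open>2 * tail |z|\<close>.\<close>

lemma Re_z_log_deriv_pos:
  assumes z: "cmod z < 1" "z \<noteq> 0" and less: "tail (cmod z) < 1 - cmod (b 1) * cmod z"
  shows "Re (z_log_deriv F z) > 0"
proof -
  define D where "D = z * deriv u z - u z + 1"
  define V where "V = u z - 1 - b 1 * z"
  note DV = quadratic_part_sums[OF z(1), folded V_def D_def]
  have plus: "(\<lambda>n. of_nat (Suc (Suc n)) * b (Suc (Suc n)) * z ^ Suc (Suc n)) sums (D + V)"
    using sums_add[OF DV(2) DV(1)] by (simp add: algebra_simps)
  have minus: "(\<lambda>n. of_nat n * b (Suc (Suc n)) * z ^ Suc (Suc n)) sums (D - V)"
    using sums_diff[OF DV(2) DV(1)] by (simp add: algebra_simps)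
  let ?T = "\<lambda>d. (\<lambda>n. d n * cmod (b (Suc (Suc n))) * cmod z ^ Suc (Suc n))"
  have ts: "summable (?T (\<lambda>n. real (Suc n)))"
    using tail_sums[of "cmod z"] z sums_summable by auto
  have s0: "summable (?T real)"
    by (rule summable_comparison_test'[OF ts, of 0]) (simp add: mult_right_mono)
  then have s1: "summable (?T (\<lambda>n. real (Suc (Suc n))))"
    using summable_diff[OF summable_mult[OF ts, of 2] s0] by (simp add: algebra_simps)
  have "cmod (D + V) + cmod (D - V) \<le> suminf (?T (\<lambda>n. real (Suc (Suc n)))) + suminf (?T real)"
    by (intro add_mono cmod_le_majorant[OF plus _ summable_sums[OF s1]] 
          cmod_le_majorant[OF minus _ summable_sums[OF s0]]) (simp_all del: of_nat_Suc)
  also have "\<dots> = suminf (\<lambda>n. 2 * ?T (\<lambda>n. real (Suc n)) n)"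
    unfolding suminf_add[OF s1 s0] by (simp add: algebra_simps)
  also have "\<dots> = 2 * tail (cmod z)"
    unfolding tail_def using suminf_mult[OF ts, of 2] by simp
  finally have DV_le: "cmod (D + V) + cmod (D - V) \<le> 2 * tail (cmod z)" .
  have 1: "z * deriv u z = b 1 * z + (D + V)" "2 * u z - z * deriv u z = 2 + b 1 * z - (D - V)"
    by (simp_all add: D_def V_def algebra_simps)
  have "cmod (z * deriv u z) \<le> cmod (b 1) * cmod z + cmod (D + V)"
    unfolding 1(1) by (metis norm_mult norm_triangle_ineq)
  moreover have "2 - cmod (b 1) * cmod z - cmod (D - V) \<le> cmod (2 * u z - z * deriv u z)"
    unfolding 1(2) using norm_triangle_ineq2[of "2 + b 1 * z" "D - V"] norm_diff_ineq[of 2 "b 1 * z"]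
    by (simp add: norm_mult)
  ultimately have lt: "cmod (z * deriv u z) < cmod (2 * u z - z * deriv u z)"
    using DV_le less by linarith
  define q where "q = z * deriv u z / u z"
  have uz: "u z \<noteq> 0" by (rule nz[OF z(1)])
  have "cmod q < cmod (2 - q)"
  proof -
    have "2 - q = (2 * u z - z * deriv u z) / u z" using uz by (simp add: q_def field_simps)
    then show ?thesis using lt uz by (simp add: q_def norm_divide divide_strict_right_mono)
  qed
  then have "(cmod q)\<^sup>2 < (cmod (2 - q))\<^sup>2" by (intro power_strict_mono) auto
  then have "Re q < 1" unfolding cmod_power2 by (simp add: power2_eq_square algebra_simps)
  moreover have "z_log_deriv F z = 1 - q"
    using z uz by (simp add: z_log_deriv_def F DERIV_imp_deriv[OF F_deriv] q_def field_simps power2_eq_square)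
  ultimately show ?thesis by simp
qed

context
  fixes r :: real
  assumes r: "0 < r" "r \<le> 1"
begin

lemma scale_less: "cmod z < 1 \<Longrightarrow> cmod (of_real r * z) < r"
  using r by (simp add: norm_mult)

lemma dilation_deriv:
  assumes "cmod z < 1"
  shows "(dilation r F has_field_derivative deriv F (of_real r * z)) (at z)"
proof -
  have "cmod (of_real r * z) < 1" using scale_less[OF assms] r by simp
  then have "(F has_field_derivative deriv F (of_real r * z)) (at (of_real r * z))"
    using F_deriv DERIV_imp_deriv by metis
  then have "((\<lambda>z. F (of_real r * z)) has_field_derivative deriv F (of_real r * z) * of_real r) (at z)"
    by (rule DERIV_chain2[where g = "\<lambda>z. of_real r * z"]) (auto intro!: derivative_eq_intros)
  from DERIV_cdivide[OF this, of "of_real r"] show ?thesis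
    using r by (simp add: dilation_def[abs_def])
qed

lemma dilation_class_A: "dilation r F \<in> class_A"
proof -
  have "dilation r F holomorphic_on unit_disk"
    unfolding holomorphic_on_open[OF open_ball] by (meson dilation_deriv mem_ball_0)
  moreover have "deriv (dilation r F) 0 = 1"
    using DERIV_imp_deriv[OF dilation_deriv[of 0]] DERIV_imp_deriv[OF F_deriv[of 0]] by (simp add: u0)
  ultimately show ?thesis by (simp add: class_A_def dilation_def F)
qed

lemma z_over_dilation:
  assumes "cmod z < 1"
  shows "z_over (dilation r F) z = u (of_real r * z)"
proof -
  have "cmod (of_real r * z) < 1" using scale_less[OF assms] r by simp
  then show ?thesis using r by (simp add: z_over_def dilation_def F u0)
qed

lemma dilation_class_U:
  assumes l: "0 < l" "r \<le> sqrt (l / (1 + l))"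
  shows "dilation r F \<in> class_U l"
proof -
  have "dilation r F z / z \<noteq> 0" if z: "cmod z < 1" "z \<noteq> 0" for z
  proof -
    have "cmod (of_real r * z) < 1" using scale_less[OF z(1)] r by simp
    then show ?thesis using z nz r by (simp add: dilation_def F)
  qed
  moreover have "cmod (deriv (dilation r F) z * (z_over (dilation r F) z)\<^sup>2 - 1) < l" if z: "cmod z < 1" for z
  proof -
    have rz: "cmod (of_real r * z) < r" by (rule scale_less[OF z])
    have "cmod (deriv (dilation r F) z * (z_over (dilation r F) z)\<^sup>2 - 1) \<le> tail (cmod (of_real r * z))"
      unfolding DERIV_imp_deriv[OF dilation_deriv[OF z]] z_over_dilation[OF z]
      using defect_le rz r by simp
    also have "\<dots> < l" using rz l by (intro tail_less) auto
    finally show ?thesis .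
  qed
  ultimately show ?thesis using dilation_class_A by (auto simp: class_U_def)
qed

text \<open>With \<open>|b 1| = 1 - l\<close> the radius given by \<open>l\<close> ensures
  \<open>tail < l = 1 - |b 1|\<close>, which is the condition for starlikeness; as \<open>l \<le> 1\<close>, the disk also
  lies within the disk of univalence.\<close>

lemma dilation_class_S_star:
  assumes l: "0 < l" "r \<le> sqrt (l / (1 + l))" and b1: "cmod (b 1) = 1 - l"
  shows "dilation r F \<in> class_S_star"
proof -
  have l1: "l \<le> 1" using b1 norm_ge_zero[of "b 1"] by linarith
  have r2: "r \<le> 1 / sqrt 2" using sqrt_ratio_le[OF l(1) l1] l(2) by linarith
  have "inj_on (dilation r F) unit_disk"
  proof (rule inj_onI)
    fix x y assume xy: "x \<in> unit_disk" "y \<in> unit_disk" "dilation r F x = dilation r F y"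
    then have "F (of_real r * x) = F (of_real r * y)" using r by (simp add: dilation_def)
    then have "of_real r * x = of_real r * y"
      by (rule inj_onD[OF F_inj_on]) (use scale_less[of x] scale_less[of y] xy r2 in auto)
    then show "x = y" using r by simp
  qed
  then have "dilation r F \<in> class_S"
    using dilation_class_A by (simp add: class_S_def class_A_def univalent_on_def)
  moreover have "Re (z_log_deriv (dilation r F) z) > 0" if z: "cmod z < 1" for z
  proof (cases "z = 0")
    case False
    have rz: "cmod (of_real r * z) < r" by (rule scale_less[OF z])
    have "tail (cmod (of_real r * z)) < l" using rz l by (intro tail_less) auto
    also have "l \<le> 1 - cmod (b 1) * cmod (of_real r * z)"
      using mult_left_mono[of "cmod (of_real r * z)" 1 "cmod (b 1)"] rz r b1 by simp
    finally have "Re (z_log_deriv F (of_real r * z)) > 0"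
      using rz r False by (intro Re_z_log_deriv_pos) auto
    moreover have "z_log_deriv (dilation r F) z = z_log_deriv F (of_real r * z)"
      using r False by (simp add: z_log_deriv_def DERIV_imp_deriv[OF dilation_deriv[OF z]] dilation_def)
    ultimately show ?thesis by simp
  qed (simp add: z_log_deriv_def)
  ultimately show ?thesis by (simp add: class_S_star_def)
qed

end

end

theorem theorem3:
  fixes m :: nat and f :: "nat \<Rightarrow> complex \<Rightarrow> complex" and F :: "complex \<Rightarrow> complex"
    and lambda0 :: real
  assumes m: "m \<ge> 1"
    and f_S: "\<And>k. k \<in> {1..m} \<Longrightarrow> f k \<in> class_S"
    and sum_nz: "\<And>z. z \<in> unit_disk \<Longrightarrow> (\<Sum>k=1..m. z_over (f k) z) \<noteq> 0"
    and F_0: "F 0 = 0"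
    and F_eq: "\<And>z. z \<in> unit_disk \<Longrightarrow> z_over F z = 1 / of_nat m * (\<Sum>k=1..m. z_over (f k) z)"
    and lambda0_eq: "lambda0 = 1 - 1 / real m * cmod (\<Sum>k=1..m. (deriv ^^ 2) (f k) 0 / 2)"
  shows "(\<forall>l r. 0 < l \<and> l \<le> 1 \<and> 0 < r \<and> r \<le> sqrt (l / (1 + l))
            \<longrightarrow> dilation r F \<in> class_U l)
       \<and> univalent_on F (ball 0 (1 / sqrt 2))
       \<and> (lambda0 > 0 \<longrightarrow> (\<forall>r. 0 < r \<and> r \<le> sqrt (lambda0 / (1 + lambda0))
            \<longrightarrow> dilation r F \<in> class_S_star))
       \<and> ((\<forall>k\<in>{1..m}. (deriv ^^ 2) (f k) 0 = 0) \<longrightarrow> starlike_in_disk F (1 / sqrt 2))"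
proof -
  define a where "a = (\<lambda>k n. (deriv ^^ n) (z_over (f k)) 0 / fact n)"
  define b where "b = (\<lambda>n. 1 / of_nat m * (\<Sum>k=1..m. a k n))"
  define u where "u = (\<lambda>z. 1 / of_nat m * (\<Sum>k=1..m. z_over (f k) z))"
  have a_sums: "(\<lambda>n. a k n * z ^ n) sums z_over (f k) z" if "k \<in> {1..m}" "cmod z < 1" for k z
    using holomorphic_power_series[OF z_over_class_S(1)[OF f_S[OF that(1)]], of z] that(2)
    by (simp add: a_def)
  have a_area: "(\<Sum>n<N. real (Suc n) * (cmod (a k (Suc (Suc n))))\<^sup>2) \<le> 1" if k: "k \<in> {1..m}" for k N
    using area_theorem[OF a_sums[OF k] _ z_over_class_S(2)[OF f_S[OF k]], of "Suc N"]
    unfolding sum.lessThan_Suc_shift by (simp add: z_over_def)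
  interpret area_bounded_quotient u b F
  proof
    show "(\<lambda>n. b n * z ^ n) sums u z" if "cmod z < 1" for z
      unfolding u_def b_def sum_distrib_right mult.assoc
      by (intro sums_mult sums_sum a_sums that)
    show "u 0 = 1" using m by (simp add: u_def z_over_def)
    show nz: "u z \<noteq> 0" if "cmod z < 1" for z
      using sum_nz[of z] that m by (simp add: u_def)
    show "F z = z / u z" if z: "cmod z < 1" for z
    proof (cases "z = 0")
      case False
      then have quot: "z / F z = u z" using F_eq[of z] z by (simp add: u_def z_over_def)
      then have "F z \<noteq> 0" using nz[OF z] by auto
      with quot nz[OF z] show ?thesis by (simp add: divide_eq_eq eq_divide_eq mult.commute)
    qed (use F_0 in simp)
    show "(\<Sum>n<N. real (Suc n) * (cmod (b (Suc (Suc n))))\<^sup>2) \<le> 1" for N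
    proof -
      have "(\<Sum>n<N. real (Suc n) * (cmod (b (Suc (Suc n))))\<^sup>2)
          \<le> (\<Sum>n<N. real (Suc n) * (1 / real m * (\<Sum>k=1..m. (cmod (a k (Suc (Suc n))))\<^sup>2)))"
        unfolding b_def by (intro sum_mono mult_left_mono cmod_average_square_le[OF m]) auto
      also have "\<dots> = 1 / real m * (\<Sum>k=1..m. \<Sum>n<N. real (Suc n) * (cmod (a k (Suc (Suc n))))\<^sup>2)"
        unfolding sum_distrib_left by (subst sum.swap) (simp add: mult_ac)
      also have "\<dots> \<le> 1 / real m * (\<Sum>k=1..m. 1)"
        by (intro mult_left_mono sum_mono a_area) auto
      finally show ?thesis using m by simp
    qed
  qed
  have le1: "sqrt (l / (1 + l)) \<le> 1" if "0 < l" for l :: real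
    using that by simp
  have "b 1 = - (1 / of_nat m * (\<Sum>k=1..m. (deriv ^^ 2) (f k) 0 / 2))"
    using z_over_class_S(3)[OF f_S] by (simp add: b_def a_def sum_negf)
  then have "cmod (b 1) = 1 / real m * cmod (\<Sum>k=1..m. (deriv ^^ 2) (f k) 0 / 2)"
    by (simp only: norm_minus_cancel norm_mult norm_divide norm_one norm_of_nat)
  then have b1: "cmod (b 1) = 1 - lambda0"
    using lambda0_eq by simp
  have U: "dilation r F \<in> class_U l" if "0 < l" "0 < r" "r \<le> sqrt (l / (1 + l))" for l r
    by (rule dilation_class_U[OF that(2) order_trans[OF that(3) le1[OF that(1)]] that(1,3)])
  have star: "dilation r F \<in> class_S_star" if "0 < lambda0" "0 < r" "r \<le> sqrt (lambda0 / (1 + lambda0))" for r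
    by (rule dilation_class_S_star[OF that(2) order_trans[OF that(3) le1[OF that(1)]] that(1,3) b1])
  have "ball 0 (1 / sqrt 2) \<subseteq> unit_disk"
    by (rule subset_ball) simp
  then have "univalent_on F (ball 0 (1 / sqrt 2))"
    unfolding univalent_on_def using F_inj_on holomorphic_on_subset[OF F_holomorphic] by blast
  moreover have "starlike_in_disk F (1 / sqrt 2)" if "\<forall>k\<in>{1..m}. (deriv ^^ 2) (f k) 0 = 0"
  proof -
    have "lambda0 = 1" using that by (simp add: lambda0_eq)
    then show ?thesis unfolding starlike_in_disk_def by (intro star) (auto simp: real_sqrt_divide)
  qed
  ultimately show ?thesis using U star by blast
qed

end
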